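(* Let $a\ge 1$ be an integer and let $b>0$ be real with $b\notin\{1,\dots,a-1\}$. Let $$g_{a,b}(y)=\frac{\Gamma(y+a)\,\Gamma(y+b)}{\Gamma(y)\,\Gamma(y+a+b)}\quad(y>0),$$ so that $g_{a,b}(y)=\prod_{i=0}^{a-1}\dfrac{y+i}{y+b+i}$ has no common zero–pole pair. Then $$1-g_{a,b}(y)=\sum_{i=0}^{a-1}\frac{c_i}{y+b+i},\qquad c_i=(-1)^{a+i+1}\,\frac{\prod_{j=0}^{a-1}(b+i-j)}{i!\,(a-1-i)!},\qquad \sum_{i=0}^{a-1}c_i=ab,$$ and the inverse Laplace transform of $g_{a,b}'$, i.e. the function $\rho_{a,b}$ with $g_{a,b}'(y)=\int_0^\infty e^{-yt}\rho_{a,b}(t)\,dt$ for $y>0$, is $$\rho_{a,b}(t)=t\,e^{-bt}\sum_{i=0}^{a-1}c_i\,e^{-it}=(-1)^{a+1}\,b\,t\,e^{-bt}\,P^{(b-a,\,1)}_{a-1}\bigl(1-2e^{-t}\bigr),\qquad t>0.$$ Moreover the density $\rho_{a,b}(t)\,dt$ belongs to $\mathcal M_L$.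
   Context: $P_n^{(\alpha,\beta)}$ denotes the Jacobi polynomial, defined for arbitrary parameters by the terminating hypergeometric series $P^{(\alpha,\beta)}_n(1-2x)=\binom{n+\alpha}{n}\,{}_2F_1(-n,\,1+\alpha+\beta+n;\,\alpha+1;\,x)$. $\mathcal M_L$ is the set of signed Borel measures $\mu$ on $[0,\infty)$ with $\int_{[0,\infty)}e^{-xt}\,d|\mu|(t)<\infty$ for every $x>0$. *)

theory Defs
  imports "HOL-Analysis.Analysis"
begin

text \<open>
  The Gauss hypergeometric series, and the Jacobi polynomial through it. With first argument
  \<open>-n\<close> all terms of index above \<open>n\<close> vanish. For \<open>\<alpha> \<in> {-1,\<dots>,-n}\<close> the product of the binomial
  coefficient and the series is formally \<open>0/0\<close> and classically read as a limit in \<open>\<alpha>\<close>; the value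
  below is then a mere division-by-zero convention. That case does not occur for \<open>\<alpha> = b - a\<close>,
  \<open>n = a - 1\<close> with \<open>b > 0\<close> and \<open>b \<notin> {1,\<dots>,a-1}\<close>.
\<close>

definition hypergeo_2F1 :: "'a \<Rightarrow> 'a \<Rightarrow> 'a \<Rightarrow> 'a \<Rightarrow> 'a::{real_normed_field, banach}" where
  "hypergeo_2F1 u v w x =
     (\<Sum>k. pochhammer u k * pochhammer v k / (pochhammer w k * fact k) * x ^ k)"

definition jacobi_P :: "nat \<Rightarrow> 'a \<Rightarrow> 'a \<Rightarrow> 'a \<Rightarrow> 'a::{real_normed_field, banach}" where
  "jacobi_P n \<alpha> \<beta> z =
     ((of_nat n + \<alpha>) gchoose n) *
       hypergeo_2F1 (- of_nat n) (1 + \<alpha> + \<beta> + of_nat n) (\<alpha> + 1) ((1 - z) / 2)"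

definition gamma_quot :: "nat \<Rightarrow> real \<Rightarrow> real \<Rightarrow> real" where
  "gamma_quot a b y = Gamma (y + real a) * Gamma (y + b) / (Gamma y * Gamma (y + real a + b))"

definition pf_coeff :: "nat \<Rightarrow> real \<Rightarrow> nat \<Rightarrow> real" where
  "pf_coeff a b i =
     (-1) ^ (a + i + 1) * (\<Prod>j<a. b + real i - real j) / (fact i * fact (a - 1 - i))"

definition rho :: "nat \<Rightarrow> real \<Rightarrow> real \<Rightarrow> real" where
  "rho a b t = t * exp (- b * t) * (\<Sum>i<a. pf_coeff a b i * exp (- real i * t))"

text \<open>
  \<open>f\<close> (restricted to the open half-line) is an inverse Laplace transform of \<open>G\<close> on \<open>y > 0\<close>, with
  absolutely convergent integrals.
\<close>

definition inverse_laplace :: "(real \<Rightarrow> real) \<Rightarrow> (real \<Rightarrow> real) \<Rightarrow> bool" where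
  "inverse_laplace f G \<longleftrightarrow>
     (\<forall>y>0. set_integrable lborel {0<..} (\<lambda>t. exp (- y * t) * f t) \<and>
            G y = (LBINT t:{0<..}. exp (- y * t) * f t))"

text \<open>
  A signed measure is an extended-real valued set function; only its values on the measurable sets
  of \<open>M\<close> matter, and only \<open>space M\<close> and \<open>sets M\<close> are used.
\<close>

definition signed_measure :: "'a measure \<Rightarrow> ('a set \<Rightarrow> ereal) \<Rightarrow> bool" where
  "signed_measure M \<mu> \<longleftrightarrow>
     \<mu> {} = 0 \<and>
     ((\<forall>A\<in>sets M. \<mu> A \<noteq> \<infinity>) \<or> (\<forall>A\<in>sets M. \<mu> A \<noteq> - \<infinity>)) \<and>
     (\<forall>A :: nat \<Rightarrow> 'a set. range A \<subseteq> sets M \<longrightarrow> disjoint_family A \<longrightarrow>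
        (\<lambda>i. \<mu> (A i)) sums \<mu> (\<Union>i. A i))"

definition total_variation :: "'a measure \<Rightarrow> ('a set \<Rightarrow> ereal) \<Rightarrow> 'a measure" where
  "total_variation M \<mu> = measure_of (space M) (sets M)
     (\<lambda>A. SUP F \<in> {F. finite F \<and> F \<subseteq> sets M \<and> partition_on A F}. \<Sum>B\<in>F. e2ennreal \<bar>\<mu> B\<bar>)"

definition half_line :: "real measure" where
  "half_line = restrict_space borel {0..}"

definition M_L :: "(real set \<Rightarrow> ereal) set" where
  "M_L = {\<mu>. signed_measure half_line \<mu> \<and>
             (\<forall>x>0. (\<integral>\<^sup>+t. ennreal (exp (- x * t)) \<partial>total_variation half_line \<mu>) < \<infinity>)}"

text \<open>
  The signed measure \<open>f(t) dt\<close>, as the difference of the integrals of the positive and the negative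
  part of \<open>f\<close>; meaningful when at least one of them is finite on the whole space.
\<close>

definition signed_density :: "(real \<Rightarrow> real) \<Rightarrow> real set \<Rightarrow> ereal" where
  "signed_density f A =
     enn2ereal (\<integral>\<^sup>+t\<in>A. ennreal (f t) \<partial>lborel) - enn2ereal (\<integral>\<^sup>+t\<in>A. ennreal (- f t) \<partial>lborel)"

end

theory Submission
  imports Defs "HOL-Real_Asymp.Real_Asymp"
begin

text \<open>
  The functional equation of the Gamma function turns \<open>g = gamma_quot a b\<close> into a quotient of two
  monic polynomials of degree \<open>a\<close> with the simple poles \<open>- (b + i)\<close>. So \<open>1 - g\<close> vanishes at infinity
  and equals the sum of its principal parts, and \<open>c\<^sub>i\<close> is the residue at the \<open>i\<close>-th pole
  (\<open>partial_fractions_monic_quotient\<close>). The sum of the residues is the coefficient of \<open>1 / y\<close> at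
  infinity, which is the sum of the \<open>b + i\<close> minus the sum of the \<open>i\<close>.

  Differentiation gives \<open>g'(y) = \<Sum> c\<^sub>i / (y + b + i)\<^sup>2\<close>, and \<open>1 / (y + c)\<^sup>2\<close> is the Laplace transform of
  \<open>t exp (- c t)\<close>. Hence \<open>rho\<close> is an inverse transform of \<open>g'\<close>, and it is integrable on the half-line
  because \<open>b > 0\<close>. Any other inverse transform agrees with it almost everywhere: with
  \<open>x = exp (- t)\<close> the transforms at \<open>y = 1, 2, \<dots>\<close> are the moments of a function on \<open>[0, 1]\<close>, and
  the Weierstrass approximation theorem shows that an integrable function whose moments all vanish is
  zero almost everywhere (\<open>integral_continuous_exp_eq_0\<close>, \<open>inverse_laplace_unique\<close>).

  The Jacobi form is a comparison of coefficients of powers of \<open>exp (- t)\<close> in two polynomials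
  (\<open>pf_coeff_eq_jacobi_coeff\<close>), and the density lies in \<^const>\<open>M_L\<close> because its total variation is
  at most the integral of \<open>\<bar>rho\<bar>\<close> (\<open>total_variation_signed_density_le\<close>).
\<close>

section \<open>Partial fractions of a quotient of monic products\<close>

lemma degree_prod_monic_linear:
  fixes c :: "'i \<Rightarrow> 'a::idom"
  shows "degree (\<Prod>i\<in>A. [:c i, 1:]) = card A"
  by (simp add: degree_prod_eq_sum_degree)

lemma coeff_prod_monic_linear_top:
  fixes c :: "'i \<Rightarrow> 'a::idom"
  shows "poly.coeff (\<Prod>i\<in>A. [:c i, 1:]) (card A) = 1"
  using lead_coeff_prod[of "\<lambda>i. [:c i, 1:]" A] by (simp add: degree_prod_monic_linear)

lemma coeff_prod_monic_linear_second:
  fixes c :: "'i \<Rightarrow> 'a::idom"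
  assumes "finite A" "A \<noteq> {}"
  shows "poly.coeff (\<Prod>i\<in>A. [:c i, 1:]) (card A - 1) = (\<Sum>i\<in>A. c i)"
  using assms
proof (induction A rule: finite_ne_induct)
  case (insert x F)
  then obtain m where "card F = Suc m"
    by (metis card_gt_0_iff gr0_implies_Suc)
  with insert coeff_prod_monic_linear_top[of c F] show ?case
    by (simp add: coeff_pCons)
qed simp

text \<open>
  Clearing denominators, both sides become polynomials of degree below \<open>card I\<close>: on the left the
  leading terms of the two monic products cancel. They agree at the \<open>card I\<close> points \<open>- p i\<close>, where
  all but one summand vanishes, hence they are equal. Evaluation at \<open>y\<close> gives the decomposition,
  and comparison of the coefficients of degree \<open>card I - 1\<close> gives the sum of the residues.
\<close>

lemma partial_fractions_monic_quotient:
  fixes r p :: "'i \<Rightarrow> 'a::field"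
  assumes fin: "finite I" and ne: "I \<noteq> {}" and inj: "inj_on p I"
  defines "res \<equiv> \<lambda>i. - (\<Prod>j\<in>I. r j - p i) / (\<Prod>j\<in>I - {i}. p j - p i)"
  shows "(\<And>i. i \<in> I \<Longrightarrow> y + p i \<noteq> 0) \<Longrightarrow>
           1 - (\<Prod>i\<in>I. (y + r i) / (y + p i)) = (\<Sum>i\<in>I. res i / (y + p i))"
    and "(\<Sum>i\<in>I. res i) = (\<Sum>i\<in>I. p i) - (\<Sum>i\<in>I. r i)"
proof -
  let ?lin = "\<lambda>f i. [:f i, 1:] :: 'a poly"
  define L where "L = (\<Prod>i\<in>I. ?lin p i) - (\<Prod>i\<in>I. ?lin r i)"
  define R where "R = (\<Sum>i\<in>I. smult (res i) (\<Prod>j\<in>I - {i}. ?lin p j))"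
  have card_pos: "card I > 0"
    using fin ne by (simp add: card_gt_0_iff)
  have "degree L \<le> card I"
    unfolding L_def by (rule degree_diff_le) (simp_all add: degree_prod_monic_linear)
  moreover have "poly.coeff L (card I) = 0"
    by (simp add: L_def coeff_prod_monic_linear_top)
  ultimately have degL: "degree L < card I"
    using card_pos by (metis degree_0 eq_zero_or_degree_less)
  have degR: "degree R < card I"
  proof -
    have "degree R \<le> card I - 1"
      unfolding R_def using fin
      by (intro degree_sum_le)
         (auto intro!: order.trans[OF degree_smult_le] simp: degree_prod_monic_linear)
    with card_pos show ?thesis by simp
  qed
  have "L = R"
  proof (rule poly_eqI_degree[of "(\<lambda>i. - p i) ` I"])
    show "poly L x = poly R x" if x: "x \<in> (\<lambda>i. - p i) ` I" for x
    proof -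
      from x obtain i where i: "i \<in> I" and x: "x = - p i" by blast
      have nz: "(\<Prod>j\<in>I - {i}. p j - p i) \<noteq> 0"
        using fin i inj by (auto simp: inj_on_def)
      have "poly R x = (\<Sum>k\<in>I. if k = i then res i * (\<Prod>j\<in>I - {i}. p j - p i) else 0)"
        unfolding R_def poly_sum using fin i x
        by (intro sum.cong refl) (auto simp: poly_prod)
      also have "\<dots> = res i * (\<Prod>j\<in>I - {i}. p j - p i)"
        using fin i by simp
      also have "\<dots> = - (\<Prod>j\<in>I. r j - p i)"
        using nz by (simp add: res_def)
      also have "\<dots> = poly L x"
      proof -
        have "(\<Prod>j\<in>I. p j - p i) = 0" using fin i by auto
        then show ?thesis by (simp add: L_def poly_prod x)
      qed
      finally show ?thesis ..
    qed
    have "card ((\<lambda>i. - p i) ` I) = card I"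
      using inj by (intro card_image) (auto simp: inj_on_def)
    then show "degree L < card ((\<lambda>i. - p i) ` I)" "degree R < card ((\<lambda>i. - p i) ` I)"
      using degL degR by simp_all
  qed
  show "1 - (\<Prod>i\<in>I. (y + r i) / (y + p i)) = (\<Sum>i\<in>I. res i / (y + p i))"
    if nz: "\<And>i. i \<in> I \<Longrightarrow> y + p i \<noteq> 0"
  proof -
    define D where "D = (\<Prod>i\<in>I. y + p i)"
    have D: "D \<noteq> 0" using fin nz by (simp add: D_def)
    have "poly R y = (\<Sum>i\<in>I. res i * (D / (y + p i)))"
      unfolding R_def poly_sum D_def
      by (intro sum.cong refl) (use fin nz in \<open>simp add: poly_prod prod.remove add.commute\<close>)
    also have "\<dots> = D * (\<Sum>i\<in>I. res i / (y + p i))"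
      by (simp add: sum_distrib_left mult_ac)
    finally have "D * (\<Sum>i\<in>I. res i / (y + p i)) = D - (\<Prod>i\<in>I. y + r i)"
      unfolding \<open>L = R\<close>[symmetric] by (simp add: L_def poly_prod D_def add.commute)
    then show ?thesis
      using D by (simp add: prod_dividef D_def[symmetric] field_simps)
  qed
  have "poly.coeff R (card I - 1) = (\<Sum>i\<in>I. res i)"
    unfolding R_def coeff_sum
  proof (intro sum.cong refl)
    fix i assume "i \<in> I"
    then show "poly.coeff (smult (res i) (\<Prod>j\<in>I - {i}. ?lin p j)) (card I - 1) = res i"
      using fin coeff_prod_monic_linear_top[of p "I - {i}"] by simp
  qed
  then show "(\<Sum>i\<in>I. res i) = (\<Sum>i\<in>I. p i) - (\<Sum>i\<in>I. r i)"
    unfolding \<open>L = R\<close>[symmetric] L_def coeff_diff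
      coeff_prod_monic_linear_second[OF fin ne] by (rule sym)
qed

lemma prod_differences_without_diagonal:
  assumes "i < a"
  shows "(\<Prod>j\<in>{..<a} - {i}. real j - real i) = (-1) ^ i * fact i * fact (a - 1 - i)"
proof -
  have split: "{..<a} - {i} = {..<i} \<union> {Suc i..<a}" using assms by auto
  have 1: "(\<Prod>j<i. real j - real i) = (-1) ^ i * fact i"
  proof -
    have "(\<Prod>j<i. real j - real i) = (\<Prod>j<i. (-1) * real (Suc j))"
      by (subst prod.nat_diff_reindex[symmetric]) (auto intro!: prod.cong simp: of_nat_diff)
    also have "\<dots> = (-1) ^ i * fact i"
      by (simp only: prod.distrib prod_constant card_lessThan fact_prod_Suc of_nat_prod atLeast0LessThan)
    finally show ?thesis .
  qed
  have 2: "(\<Prod>j\<in>{Suc i..<a}. real j - real i) = fact (a - 1 - i)"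
  proof -
    have "(\<Prod>j\<in>{Suc i..<a}. real j - real i) = (\<Prod>k\<in>{0..<a - 1 - i}. real (Suc k))"
      by (rule prod.reindex_bij_witness[of _ "\<lambda>k. k + Suc i" "\<lambda>j. j - Suc i"]) (auto simp: of_nat_diff)
    then show ?thesis by (simp add: fact_prod_Suc)
  qed
  show ?thesis
    unfolding split by (subst prod.union_disjoint) (auto simp: 1 2)
qed

text \<open>
  The sign of \<^const>\<open>pf_coeff\<close> collects the \<open>a\<close> sign changes of the numerator factors, the \<open>i\<close>
  negative factors \<open>j - i\<close> with \<open>j < i\<close> of the denominator, and the minus sign in \<open>1 - g\<close>.
\<close>

lemma pf_coeff_eq_residue:
  assumes "i < a"
  shows "pf_coeff a b i =
    - (\<Prod>j<a. real j - (b + real i)) / (\<Prod>j\<in>{..<a} - {i}. (b + real j) - (b + real i))"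
proof -
  have "(\<Prod>j<a. real j - (b + real i)) = (\<Prod>j<a. (-1) * (b + real i - real j))"
    by (intro prod.cong) auto
  also have "\<dots> = (-1) ^ a * (\<Prod>j<a. b + real i - real j)"
    by (simp only: prod.distrib prod_constant card_lessThan)
  finally show ?thesis
    using assms by (simp add: pf_coeff_def prod_differences_without_diagonal power_add field_simps)
qed

lemma gamma_quot_eq_prod:
  assumes "y > 0" "b > 0"
  shows "gamma_quot a b y = (\<Prod>i<a. (y + real i) / (y + b + real i))"
proof -
  have *: "Gamma (x + real a) = (\<Prod>i<a. x + real i) * Gamma x" if "x > 0" for x :: real
  proof -
    have "x \<notin> \<int>\<^sub>\<le>\<^sub>0" using that by (auto elim!: nonpos_Ints_cases)
    with pochhammer_Gamma[of x a] Gamma_real_pos[OF that] show ?thesis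
      by (simp add: pochhammer_prod field_simps atLeast0LessThan)
  qed
  have "Gamma y \<noteq> 0" "Gamma (y + b) \<noteq> 0"
    using assms by (metis Gamma_real_pos less_irrefl, metis Gamma_real_pos add_pos_pos less_irrefl)
  moreover have "Gamma (y + real a + b) = (\<Prod>i<a. y + b + real i) * Gamma (y + b)"
    using *[of "y + b"] assms by (simp add: add_ac)
  ultimately show ?thesis
    using * assms by (simp add: gamma_quot_def prod_dividef)
qed

lemma one_minus_gamma_quot:
  assumes "y > 0" "b > 0" "a \<ge> 1"
  shows "1 - gamma_quot a b y = (\<Sum>i<a. pf_coeff a b i / (y + b + real i))"
proof -
  have "1 - (\<Prod>i<a. (y + real i) / (y + (b + real i))) = 
        (\<Sum>i<a. pf_coeff a b i / (y + (b + real i)))"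
    using assms
    by (subst partial_fractions_monic_quotient(1)[of "{..<a}" "\<lambda>i. b + real i" y real])
       (auto simp: inj_on_def pf_coeff_eq_residue lessThan_empty_iff intro!: sum.cong)
  then show ?thesis
    using assms by (simp add: gamma_quot_eq_prod add_ac)
qed

lemma sum_pf_coeff:
  assumes "a \<ge> 1"
  shows "(\<Sum>i<a. pf_coeff a b i) = real a * b"
proof -
  have "(\<Sum>i<a. pf_coeff a b i) = (\<Sum>i<a. b + real i) - (\<Sum>i<a. real i)"
    using assms
    by (subst partial_fractions_monic_quotient(2)[of "{..<a}" "\<lambda>i. b + real i" real, symmetric])
       (auto simp: inj_on_def pf_coeff_eq_residue lessThan_empty_iff intro!: sum.cong)
  then show ?thesis by (simp add: sum.distrib)
qed

lemma gamma_quot_has_derivative: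
  assumes "y > 0" "b > 0" "a \<ge> 1"
  shows "(gamma_quot a b has_field_derivative
           (\<Sum>i<a. pf_coeff a b i / (y + b + real i)\<^sup>2)) (at y)"
proof (rule has_field_derivative_transform_within_open)
  have "((\<lambda>z. pf_coeff a b i / (z + b + real i)) has_field_derivative
          - (pf_coeff a b i / (y + b + real i)\<^sup>2)) (at y)" for i
    using assms by (auto intro!: derivative_eq_intros simp: power2_eq_square)
  then have "((\<lambda>z. 1 - (\<Sum>i<a. pf_coeff a b i / (z + b + real i))) has_field_derivative
          0 - (\<Sum>i<a. - (pf_coeff a b i / (y + b + real i)\<^sup>2))) (at y)"
    by (intro DERIV_diff DERIV_const DERIV_sum)
  then show "((\<lambda>z. 1 - (\<Sum>i<a. pf_coeff a b i / (z + b + real i))) has_field_derivative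
          (\<Sum>i<a. pf_coeff a b i / (y + b + real i)\<^sup>2)) (at y)"
    by (simp add: sum_negf)
  show "1 - (\<Sum>i<a. pf_coeff a b i / (z + b + real i)) = gamma_quot a b z" if "z \<in> {0<..}" for z
    using one_minus_gamma_quot[of z b a] that assms by simp
qed (use assms in auto)

section \<open>The Jacobi polynomial\<close>

text \<open>
  The excluded values of \<open>b\<close> are exactly those for which the lower parameter \<open>b - a + 1\<close> of the
  hypergeometric series makes a denominator vanish before the series terminates. Otherwise the
  binomial coefficient in front of the series completes the quotient of Pochhammer symbols to the
  product in the definition of \<^const>\<open>pf_coeff\<close>.
\<close>

lemma pf_coeff_eq_jacobi_coeff:
  assumes "k < a" "b \<notin> real ` {1..<a}"
  shows "pf_coeff a b k = (-1) ^ (a + 1) * b * ((b - 1) gchoose (a - 1)) *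
    (pochhammer (- real (a - 1)) k * pochhammer (b + 1) k / (pochhammer (b - real a + 1) k * fact k))"
proof -
  have top: "(b - 1) gchoose (a - 1) = pochhammer (b - real a + 1) (a - 1) / fact (a - 1)"
    using assms by (simp add: gbinomial_pochhammer' of_nat_diff algebra_simps)
  have neg: "pochhammer (- real (a - 1)) k = (-1) ^ k * fact (a - 1) / fact (a - 1 - k)"
  proof -
    have "pochhammer (- real (a - 1)) k = (-1) ^ k * pochhammer (real (a - 1) - real k + 1) k"
      by (simp add: pochhammer_minus)
    moreover have "real (a - 1) - real k + 1 = 1 + real (a - 1 - k)"
      using assms by (simp add: of_nat_diff)
    moreover have "pochhammer (1 + real (a - 1 - k)) k = fact (a - 1) / fact (a - 1 - k)"
      using pochhammer_product'[of "1::real" "a - 1 - k" k] assms by (simp add: pochhammer_fact[symmetric] field_simps)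
    ultimately show ?thesis by (metis times_divide_eq_right add.commute)
  qed
  have bot: "pochhammer (b - real a + 1) k \<noteq> 0"
  proof
    assume "pochhammer (b - real a + 1) k = 0"
    then obtain j where "j < k" and "b - real a + 1 = - real j"
      by (auto simp: pochhammer_eq_0_iff)
    then have "b = real (a - 1 - j)" "a - 1 - j \<in> {1..<a}"
      using assms by (auto simp: of_nat_diff)
    with assms show False by blast
  qed
  \<comment> \<open>the increasing product \<open>(b - a + 1) \<dots> (b + k)\<close>, split once around the factor \<open>b\<close>
    and once after its first \<open>k\<close> factors\<close>
  have "pochhammer (b - real a + 1) (a - 1) * b * pochhammer (b + 1) k = pochhammer (b - real a + 1) (a + k)"
  proof -
    have "pochhammer (b - real a + 1) (a - 1 + Suc k) = 
       pochhammer (b - real a + 1) (a - 1) * pochhammer (b - real a + 1 + real (a - 1)) (Suc k)"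
       by (rule pochhammer_product')
    then show ?thesis using assms by (simp add: of_nat_diff pochhammer_rec)
  qed
  moreover have "pochhammer (b - real a + 1) (k + a) = 
       pochhammer (b - real a + 1) k * pochhammer (b - real a + 1 + real k) a"
     by (rule pochhammer_product')
  moreover have "pochhammer (b - real a + 1 + real k) a = (\<Prod>j<a. b + real k - real j)"
    unfolding pochhammer_prod_rev lessThan_atLeast0
    by (rule prod.reindex_bij_witness[of _ Suc "\<lambda>i. i - 1"]) (auto simp: of_nat_diff algebra_simps)
  ultimately have "pochhammer (b - real a + 1) (a - 1) * b * pochhammer (b + 1) k =
     pochhammer (b - real a + 1) k * (\<Prod>j<a. b + real k - real j)" by (simp add: add.commute)
  then have key: "pochhammer (b - real a + 1) (a - 1) * b * pochhammer (b + 1) k / pochhammer (b - real a + 1) k = (\<Prod>j<a. b + real k - real j)"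
    using bot by (simp add: field_simps)
  show ?thesis
    unfolding pf_coeff_def key[symmetric] top neg
    using bot by (simp add: field_simps power_add)
qed

lemma rho_eq_jacobi:
  assumes "a \<ge> 1" "b \<notin> real ` {1..<a}"
  shows "rho a b t = (-1) ^ (a + 1) * b * t * exp (- b * t) *
         jacobi_P (a - 1) (b - real a) 1 (1 - 2 * exp (- t))"
proof -
  let ?h = "\<lambda>k. pochhammer (- real (a - 1)) k * pochhammer (b + 1) k / (pochhammer (b - real a + 1) k * fact k)"
  have "hypergeo_2F1 (- real (a - 1)) (b + 1) (b - real a + 1) (exp (- t)) = (\<Sum>k<a. ?h k * exp (- t) ^ k)"
    unfolding hypergeo_2F1_def
    by (rule suminf_finite) (use assms in \<open>auto simp: pochhammer_of_nat_eq_0_iff simp del: of_nat_diff\<close>)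
  moreover have "1 + (b - real a) + 1 + real (a - 1) = b + 1" "real (a - 1) + (b - real a) = b - 1"
    using assms by (auto simp: of_nat_diff)
  ultimately have P: "jacobi_P (a - 1) (b - real a) 1 (1 - 2 * exp (- t)) = 
     ((b - 1) gchoose (a - 1)) * (\<Sum>k<a. ?h k * exp (- t) ^ k)"
    unfolding jacobi_P_def by (simp only: diff_diff_eq2 add_diff_cancel_left' mult_1_left) simp
  have "(\<Sum>i<a. pf_coeff a b i * exp (- real i * t)) =
      (\<Sum>k<a. (-1) ^ (a + 1) * b * ((b - 1) gchoose (a - 1)) * (?h k * exp (- t) ^ k))"
    by (intro sum.cong refl) (use assms in \<open>simp add: pf_coeff_eq_jacobi_coeff exp_of_nat_mult[symmetric] del: of_nat_diff\<close>)
  also have "\<dots> = (-1) ^ (a + 1) * b * jacobi_P (a - 1) (b - real a) 1 (1 - 2 * exp (- t))"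
    unfolding P sum_distrib_left by (simp only: mult.assoc)
  finally show ?thesis by (simp add: rho_def)
qed

section \<open>Laplace transform of the density\<close>

lemma laplace_t_exp:
  fixes c :: real
  assumes "c > 0"
  shows "has_bochner_integral lborel (\<lambda>t. indicator {0<..} t * (t * exp (- c * t))) (1 / c\<^sup>2)"
proof (rule has_bochner_integral_nn_integral)
  let ?F = "\<lambda>t. - (t / c + 1 / c\<^sup>2) * exp (- c * t)"
  have "(\<integral>\<^sup>+t. ennreal (indicator {0<..} t * (t * exp (- c * t))) \<partial>lborel) =
        (\<integral>\<^sup>+t. ennreal (t * exp (- c * t)) * indicator {0..} t \<partial>lborel)"
    by (intro nn_integral_cong) (auto simp: indicator_def)
  also have "\<dots> = 0 - ?F 0"
  proof (rule nn_integral_FTC_atLeast)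
    show "(?F has_field_derivative t * exp (- c * t)) (at t)" for t
      using assms by (auto intro!: derivative_eq_intros simp: field_simps power2_eq_square)
    show "(?F \<longlongrightarrow> 0) at_top"
      using assms by real_asymp
  qed auto
  finally show "(\<integral>\<^sup>+t. ennreal (indicator {0<..} t * (t * exp (- c * t))) \<partial>lborel) = ennreal (1 / c\<^sup>2)"
    by simp
qed (auto simp: indicator_def)

text \<open>
  The factor \<open>exp (- b * t)\<close> of \<open>rho\<close> makes the transform converge up to \<open>y > - b\<close>. Besides
  \<open>y > 0\<close>, the value \<open>y = 0\<close> matters: it makes \<open>rho\<close> itself absolutely integrable.
\<close>

lemma laplace_rho:
  assumes "y > - b"
  shows "has_bochner_integral lborel (\<lambda>t. indicator {0<..} t * (exp (- y * t) * rho a b t))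
          (\<Sum>i<a. pf_coeff a b i / (y + b + real i)\<^sup>2)"
proof -
  have eq: "(\<lambda>t. indicator {0<..} t * (exp (- y * t) * rho a b t)) =
        (\<lambda>t. \<Sum>i<a. pf_coeff a b i * (indicator {0<..} t * (t * exp (- (y + b + real i) * t))))"
  proof
    fix t
    have "exp (- (y + b + real i) * t) = exp (- y * t) * exp (- b * t) * exp (- real i * t)" for i
      by (simp add: exp_add[symmetric] algebra_simps)
    then show "indicator {0<..} t * (exp (- y * t) * rho a b t) =
      (\<Sum>i<a. pf_coeff a b i * (indicator {0<..} t * (t * exp (- (y + b + real i) * t))))"
      by (simp add: rho_def sum_distrib_left mult_ac)
  qed
  have "has_bochner_integral lborel (\<lambda>t. pf_coeff a b i * (indicator {0<..} t * (t * exp (- (y + b + real i) * t))))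
         (pf_coeff a b i * (1 / (y + b + real i)\<^sup>2))" for i
    by (intro has_bochner_integral_mult_right laplace_t_exp) (use assms in simp)
  then have "has_bochner_integral lborel (\<lambda>t. \<Sum>i<a. pf_coeff a b i * (indicator {0<..} t * (t * exp (- (y + b + real i) * t))))
         (\<Sum>i<a. pf_coeff a b i * (1 / (y + b + real i)\<^sup>2))"
    by (intro has_bochner_integral_sum)
  then show ?thesis unfolding eq by simp
qed

lemma set_integrable_rho:
  assumes "b > 0"
  shows "set_integrable lborel {0..} (rho a b)"
proof -
  \<comment> \<open>the Laplace integral at \<open>y = 0\<close>; the end point may be added because \<open>rho a b 0 = 0\<close>\<close>
  have "(\<lambda>t. indicator {0<..} t * (exp (- 0 * t) * rho a b t)) = (\<lambda>t. indicator {0..} t *\<^sub>R rho a b t)"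
    by (auto simp: fun_eq_iff indicator_def rho_def)
  then show ?thesis
    using laplace_rho[of b 0 a] assms unfolding set_integrable_def
    by (simp add: has_bochner_integral_iff)
qed

section \<open>Uniqueness of the inverse Laplace transform\<close>

text \<open>
  The densities \<open>max 0 h\<close> and \<open>max 0 (- h)\<close> define two finite measures that agree on all rays, and
  rays generate the Borel sets.
\<close>

lemma AE_eq_0_if_ray_integrals_eq_0:
  fixes h :: "real \<Rightarrow> real"
  assumes int: "integrable lborel h" and rays: "\<And>s. (LBINT t. indicator {s<..} t * h t) = 0"
  shows "AE t in lborel. h t = 0"
proof -
  have [measurable]: "h \<in> borel_measurable borel" using int by auto
  define M where "M = density lborel (\<lambda>t. ennreal (h t))"
  define N where "N = density lborel (\<lambda>t. ennreal (- h t))"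
  have em: "emeasure (density lborel (\<lambda>t. ennreal (k t))) A =
      ennreal (LBINT t. indicator A t * max 0 (k t))"
    if k: "integrable lborel k" and [measurable]: "A \<in> sets borel" for k A
  proof -
    have [measurable]: "k \<in> borel_measurable borel" using k by auto
    have "integrable lborel (\<lambda>t. indicator A t * max 0 (k t))"
      using integrable_real_mult_indicator[of A lborel "\<lambda>t. max 0 (k t)"] k
      by (simp add: mult.commute)
    then have "(\<integral>\<^sup>+t. ennreal (indicator A t * max 0 (k t)) \<partial>lborel) =
        ennreal (LBINT t. indicator A t * max 0 (k t))"
      by (rule nn_integral_eq_integral) (simp add: AE_I2)
    moreover have "ennreal (k t) * indicator A t = ennreal (indicator A t * max 0 (k t))" for t
      by (auto simp: indicator_def max_def ennreal_neg)
    ultimately show ?thesis by (simp add: emeasure_density)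
  qed
  have eq_iff: "emeasure M A = emeasure N A \<longleftrightarrow> (LBINT t. indicator A t * h t) = 0"
    if A: "A \<in> sets borel" for A
  proof -
    let ?I = "\<lambda>k. LBINT t. indicator A t * max 0 (k t)"
    have i: "integrable lborel (\<lambda>t. indicator A t * max 0 (k t))" if "integrable lborel k"
      for k :: "real \<Rightarrow> real"
      using integrable_real_mult_indicator[of A lborel "\<lambda>t. max 0 (k t)"] that A
      by (simp add: mult.commute)
    have pos: "0 \<le> ?I k" for k :: "real \<Rightarrow> real"
      by (rule Bochner_Integration.integral_nonneg) simp
    have "emeasure M A = emeasure N A \<longleftrightarrow> ?I h = ?I (\<lambda>t. - h t)"
      unfolding M_def N_def using em[of h A] em[of "\<lambda>t. - h t" A] int A pos by simp
    also have "\<dots> \<longleftrightarrow> ?I h - ?I (\<lambda>t. - h t) = 0"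
      by (rule right_minus_eq[symmetric])
    also have "?I h - ?I (\<lambda>t. - h t) =
        (LBINT t. indicator A t * max 0 (h t) - indicator A t * max 0 (- h t))"
      by (rule Bochner_Integration.integral_diff[symmetric]) (intro i; use int in simp)+
    also have "\<dots> = (LBINT t. indicator A t * h t)"
      by (rule Bochner_Integration.integral_cong) (auto simp: indicator_def max_def)
    finally show ?thesis .
  qed
  have "M = N"
  proof (rule measure_eqI_lessThan)
    show "sets M = sets borel" "sets N = sets borel" by (simp_all add: M_def N_def)
    show "emeasure M {s<..} < \<infinity>" for s using em[OF int] by (simp add: M_def)
    show "emeasure M {s<..} = emeasure N {s<..}" for s using rays[of s] by (simp add: eq_iff)
  qed
  then show ?thesis
    using eq_iff by (intro density_unique_real[OF int]) (auto simp: set_lebesgue_integral_def)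
qed

text \<open>
  The moment condition says that every polynomial in \<open>exp (- t)\<close> integrates to zero against \<open>h\<close>. On
  the support of \<open>h\<close> the variable \<open>exp (- t)\<close> stays in the compact interval \<open>[0, 1]\<close>, so the Weierstrass
  approximation theorem extends this to continuous functions of \<open>exp (- t)\<close>.
\<close>

lemma integral_continuous_exp_eq_0:
  fixes h :: "real \<Rightarrow> real"
  assumes int: "integrable lborel h" and supp: "\<And>t. t \<le> 0 \<Longrightarrow> h t = 0"
    and mom: "\<And>n::nat. (LBINT t. exp (- t) ^ n * h t) = 0"
    and \<phi>: "continuous_on UNIV \<phi>"
  shows "(LBINT t. \<phi> (exp (- t)) * h t) = 0"
proof -
  have [measurable]: "h \<in> borel_measurable borel" using int by auto
  have bdd: "integrable lborel (\<lambda>t. \<phi> (exp (- t)) * h t)"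
    if [measurable]: "\<phi> \<in> borel_measurable borel" and B: "\<And>x. x \<in> {0..1} \<Longrightarrow> \<bar>\<phi> x\<bar> \<le> B"
    for \<phi> :: "real \<Rightarrow> real" and B
  proof (rule Bochner_Integration.integrable_bound)
    show "integrable lborel (\<lambda>t. B * h t)" using int by simp
    have "\<bar>\<phi> (exp (- t)) * h t\<bar> \<le> \<bar>B * h t\<bar>" for t
    proof (cases "t \<le> 0")
      case False
      then have "\<bar>\<phi> (exp (- t))\<bar> \<le> \<bar>B\<bar>" using B[of "exp (- t)"] by auto
      then show ?thesis unfolding abs_mult by (intro mult_right_mono) auto
    qed (simp add: supp)
    then show "AE t in lborel. norm (\<phi> (exp (- t)) * h t) \<le> norm (B * h t)" by simp
  qed simp
  have bound: "\<exists>B. \<forall>x\<in>{0..1}. \<bar>\<psi> x\<bar> \<le> B" if "continuous_on UNIV \<psi>" for \<psi> :: "real \<Rightarrow> real"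
  proof -
    have "compact (\<psi> ` {0..1})"
      using that by (intro compact_continuous_image) (auto intro: continuous_on_subset)
    from compact_imp_bounded[OF this] show ?thesis by (auto simp: bounded_iff)
  qed
  have ints: "integrable lborel (\<lambda>t. \<psi> (exp (- t)) * h t)" if "continuous_on UNIV \<psi>" for \<psi> :: "real \<Rightarrow> real"
    using bound[OF that] bdd[of \<psi>] borel_measurable_continuous_onI[OF that] by blast
  have small: "\<bar>LBINT t. \<phi> (exp (- t)) * h t\<bar> \<le> e * (LBINT t. \<bar>h t\<bar>)" if "e > 0" for e
  proof -
    obtain q where "real_polynomial_function q" and q: "\<And>x. x \<in> {0..1} \<Longrightarrow> \<bar>\<phi> x - q x\<bar> < e"
      using Stone_Weierstrass_real_polynomial_function[of "{0..1::real}" \<phi> e] \<phi> \<open>e > 0\<close>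
      by (auto intro: continuous_on_subset)
    then obtain c n where q_eq: "q = (\<lambda>x. \<Sum>i\<le>n. c i * x ^ i)"
      by (auto simp: real_polynomial_function_iff_sum)
    have q_cont: "continuous_on UNIV q" unfolding q_eq by (intro continuous_intros)
    have powers: "integrable lborel (\<lambda>t. exp (- t) ^ i * h t)" for i :: nat
      using ints[of "\<lambda>x. x ^ i"] by (simp add: continuous_intros)
    have "(LBINT t. q (exp (- t)) * h t) = (LBINT t. \<Sum>i\<le>n. c i * (exp (- t) ^ i * h t))"
      by (simp add: q_eq sum_distrib_right mult.assoc)
    also have "\<dots> = (\<Sum>i\<le>n. c i * (LBINT t. exp (- t) ^ i * h t))"
      by (subst Bochner_Integration.integral_sum) (auto intro: powers)
    also have "\<dots> = 0" by (simp add: mom)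
    finally have "(LBINT t. q (exp (- t)) * h t) = 0" .
    then have "(LBINT t. \<phi> (exp (- t)) * h t) = (LBINT t. \<phi> (exp (- t)) * h t - q (exp (- t)) * h t)"
      using ints[OF \<phi>] ints[OF q_cont] by simp
    also have "\<bar>\<dots>\<bar> \<le> (LBINT t. \<bar>\<phi> (exp (- t)) * h t - q (exp (- t)) * h t\<bar>)"
      by (rule integral_abs_bound)
    also have "\<dots> \<le> (LBINT t. e * \<bar>h t\<bar>)"
    proof (rule integral_mono)
      show "integrable lborel (\<lambda>t. \<bar>\<phi> (exp (- t)) * h t - q (exp (- t)) * h t\<bar>)"
        using ints[OF \<phi>] ints[OF q_cont] by simp
      show "integrable lborel (\<lambda>t. e * \<bar>h t\<bar>)" using int by simp
      show "\<bar>\<phi> (exp (- t)) * h t - q (exp (- t)) * h t\<bar> \<le> e * \<bar>h t\<bar>" for t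
      proof (cases "t \<le> 0")
        case False
        then have "\<bar>\<phi> (exp (- t)) - q (exp (- t))\<bar> \<le> e" using q[of "exp (- t)"] by auto
        then show ?thesis unfolding left_diff_distrib[symmetric] abs_mult by (rule mult_right_mono) simp
      qed (simp add: supp)
    qed
    finally show ?thesis by simp
  qed
  have "((\<lambda>e. e * (LBINT t. \<bar>h t\<bar>)) \<longlongrightarrow> 0 * (LBINT t. \<bar>h t\<bar>)) (at_right 0)"
    by (intro tendsto_intros)
  then have "\<bar>LBINT t. \<phi> (exp (- t)) * h t\<bar> \<le> 0 * (LBINT t. \<bar>h t\<bar>)"
    by (rule tendsto_lowerbound[OF _ eventually_mono[OF eventually_at_right_less]])
      (use small in auto)
  then show ?thesis by simp
qed

lemma ray_integral_eq_0:
  fixes h :: "real \<Rightarrow> real"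
  assumes int: "integrable lborel h" and supp: "\<And>t. t \<le> 0 \<Longrightarrow> h t = 0"
    and mom: "\<And>n::nat. (LBINT t. exp (- t) ^ n * h t) = 0"
  shows "(LBINT t. indicator {s<..} t * h t) = 0"
proof -
  have [measurable]: "h \<in> borel_measurable borel" using int by auto
  \<comment> \<open>continuous ramps that increase to the indicator of \<open>x < exp (- s)\<close>, that is, of \<open>t > s\<close>\<close>
  define \<phi> :: "nat \<Rightarrow> real \<Rightarrow> real" where "\<phi> m x = min 1 (max 0 (real m * (exp (- s) - x)))" for m x
  have \<phi>_cont: "continuous_on UNIV (\<phi> m)" for m unfolding \<phi>_def by (intro continuous_intros)
  note [measurable] = borel_measurable_continuous_onI[OF \<phi>_cont]
  have "(\<lambda>m. LBINT t. \<phi> m (exp (- t)) * h t) \<longlonglongrightarrow> (LBINT t. indicator {s<..} t * h t)"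
  proof (rule integral_dominated_convergence)
    show "integrable lborel (\<lambda>t. \<bar>h t\<bar>)" using int by simp
    show "AE t in lborel. norm (\<phi> m (exp (- t)) * h t) \<le> \<bar>h t\<bar>" for m
    proof (rule AE_I2)
      have "\<bar>\<phi> m (exp (- t))\<bar> \<le> 1" for t by (auto simp: \<phi>_def)
      then show "norm (\<phi> m (exp (- t)) * h t) \<le> \<bar>h t\<bar>" for t
        unfolding real_norm_def abs_mult by (intro mult_left_le_one_le) auto
    qed
    have "(\<lambda>m. \<phi> m (exp (- t))) \<longlonglongrightarrow> indicator {s<..} t" for t
    proof (cases "s < t")
      case True
      define d where "d = exp (- s) - exp (- t)"
      have "d > 0" using True by (simp add: d_def)
      have "eventually (\<lambda>m. 1 \<le> real m * d) sequentially"
        using \<open>d > 0\<close> by real_asymp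
      then have "eventually (\<lambda>m. \<phi> m (exp (- t)) = 1) sequentially"
        by eventually_elim (auto simp: \<phi>_def d_def)
      then show ?thesis using True by (simp add: tendsto_eventually)
    next
      case False
      then have "real m * (exp (- s) - exp (- t)) \<le> 0" for m
        by (intro mult_nonneg_nonpos) auto
      then show ?thesis using False by (simp add: \<phi>_def max_absorb1)
    qed
    then show "AE t in lborel. (\<lambda>m. \<phi> m (exp (- t)) * h t) \<longlonglongrightarrow> indicator {s<..} t * h t"
      by (intro AE_I2 tendsto_mult tendsto_const)
  qed auto
  then show ?thesis by (simp add: integral_continuous_exp_eq_0[OF assms \<phi>_cont] LIMSEQ_const_iff)
qed

text \<open>
  Multiplied by \<open>exp (- t)\<close>, the difference of two inverse transforms is integrable on the half-line
  and has vanishing moments in \<open>exp (- t)\<close>: its moment of order \<open>n\<close> is the difference of the two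
  Laplace transforms at \<open>y = n + 1\<close>.
\<close>

lemma inverse_laplace_unique:
  assumes f: "inverse_laplace f G" and g: "inverse_laplace g G"
  shows "AE t in lborel. t > 0 \<longrightarrow> f t = g t"
proof -
  let ?T = "\<lambda>k y t. indicator {0<..} t * (exp (- y * t) * k t) :: real"
  have T: "integrable lborel (?T k y)" "(LBINT t. ?T k y t) = G y"
    if "inverse_laplace k G" "y > 0" for k y
    using that by (auto simp: inverse_laplace_def set_integrable_def set_lebesgue_integral_def)
  define h where "h t = ?T f 1 t - ?T g 1 t" for t
  have int: "integrable lborel h"
    unfolding h_def using T(1)[OF f, of 1] T(1)[OF g, of 1] by simp
  have "(LBINT t. indicator {s<..} t * h t) = 0" for s
  proof (rule ray_integral_eq_0[OF int])
    show "h t = 0" if "t \<le> 0" for t using that by (simp add: h_def)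
    fix n :: nat
    have "exp (- t) ^ n * h t = ?T f (real n + 1) t - ?T g (real n + 1) t" for t
    proof -
      have "exp (- (real n + 1) * t) = exp (- t) ^ n * exp (- 1 * t)"
        by (simp add: exp_of_nat_mult[symmetric] exp_add[symmetric] algebra_simps)
      then show ?thesis by (simp add: h_def algebra_simps)
    qed
    then show "(LBINT t. exp (- t) ^ n * h t) = 0"
      using T[OF f, of "real n + 1"] T[OF g, of "real n + 1"] by simp
  qed
  from AE_eq_0_if_ray_integrals_eq_0[OF int this] show ?thesis
    by eventually_elim (auto simp: h_def)
qed

section \<open>Signed measures with an integrable density\<close>

text \<open>
  For an integrable density the two extended-real parts are finite, so the subtraction is one of
  real numbers.
\<close>

lemma signed_density_eq_integral:
  assumes f: "set_integrable lborel A f" and A: "A \<in> sets borel"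
  shows "signed_density f A = ereal (LBINT t:A. f t)"
proof -
  have int: "integrable lborel (\<lambda>t. indicator A t * f t)"
    using f by (simp add: set_integrable_def)
  have part: "(\<integral>\<^sup>+t\<in>A. ennreal (k t) \<partial>lborel) = ennreal (LBINT t. max 0 (indicator A t * k t))"
    if "integrable lborel (\<lambda>t. indicator A t * k t)" for k
  proof -
    have "(\<integral>\<^sup>+t\<in>A. ennreal (k t) \<partial>lborel) = (\<integral>\<^sup>+t. ennreal (max 0 (indicator A t * k t)) \<partial>lborel)"
      by (intro nn_integral_cong) (auto simp: indicator_def max_def ennreal_neg)
    also have "\<dots> = ennreal (LBINT t. max 0 (indicator A t * k t))"
      using that by (intro nn_integral_eq_integral) auto
    finally show ?thesis .
  qed
  have "signed_density f A = ereal ((LBINT t. max 0 (indicator A t * f t)) - (LBINT t. max 0 (indicator A t * - f t)))"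
    unfolding signed_density_def using part[of f] part[of "\<lambda>t. - f t"] int
    by (simp add: enn2ereal_ennreal)
  also have "(LBINT t. max 0 (indicator A t * f t)) - (LBINT t. max 0 (indicator A t * - f t)) =
     (LBINT t. max 0 (indicator A t * f t) - max 0 (indicator A t * - f t))"
    using int by (intro Bochner_Integration.integral_diff[symmetric]) auto
  also have "\<dots> = (LBINT t:A. f t)"
    unfolding set_lebesgue_integral_def
    by (intro Bochner_Integration.integral_cong) (auto simp: max_def)
  finally show ?thesis .
qed

lemma sets_half_lineD:
  assumes "A \<in> sets half_line" shows "A \<in> sets borel" "A \<subseteq> {0..}"
  using assms by (auto simp: half_line_def sets_restrict_space)

lemma signed_measure_signed_density:
  assumes f: "set_integrable lborel {0..} f"
  shows "signed_measure half_line (signed_density f)"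
proof -
  have eq: "signed_density f A = ereal (LBINT t:A. f t)" if "A \<in> sets half_line" for A
    using that set_integrable_subset[OF f] sets_half_lineD[OF that]
    by (intro signed_density_eq_integral) auto
  have "(\<lambda>i. signed_density f (A i)) sums signed_density f (\<Union>i. A i)"
    if A: "range A \<subseteq> sets half_line" and disj: "disjoint_family A" for A :: "nat \<Rightarrow> real set"
  proof -
    have Ai: "A i \<in> sets half_line" for i using A by auto
    have un: "(\<Union>i. A i) \<in> sets half_line" using A by auto
    have int: "set_integrable lborel (\<Union>i. A i) f"
      using set_integrable_subset[OF f] sets_half_lineD[OF un] by simp
    have "(\<lambda>i. LBINT t:A i. f t) sums (LBINT t:(\<Union>i. A i). f t)"
    proof -
      have fin: "(\<Sum>i<n. LBINT t:A i. f t) = (LBINT t:(\<Union>i<n. A i). f t)" for n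
      proof (rule set_integral_finite_Union[symmetric])
        show "disjoint_family_on A {..<n}"
          using disj by (rule disjoint_family_on_mono[rotated]) simp
        show "A i \<in> sets lborel" for i using sets_half_lineD[OF Ai] by simp
        show "set_integrable lborel (A i) f" for i
          using set_integrable_subset[OF f] sets_half_lineD[OF Ai] by simp
      qed simp
      have UN: "(\<Union>n. \<Union>i<n. A i) = (\<Union>i. A i)" by auto
      have "(\<lambda>n. LBINT t:(\<Union>i<n. A i). f t) \<longlonglongrightarrow> (LBINT t:(\<Union>n. \<Union>i<n. A i). f t)"
      proof (rule set_integral_cont_up)
        show "(\<Union>i<n. A i) \<in> sets lborel" for n using sets_half_lineD[OF Ai] by auto
        show "incseq (\<lambda>n. \<Union>i<n. A i)"
          unfolding incseq_def by (meson UN_mono lessThan_subset_iff order_refl)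
        show "set_integrable lborel (\<Union>n. \<Union>i<n. A i) f" using int by (simp only: UN)
      qed
      then show ?thesis unfolding sums_def fin UN .
    qed
    then show ?thesis by (simp only: eq[OF Ai] eq[OF un] sums_ereal)
  qed
  then show ?thesis
    using eq by (auto simp: signed_measure_def signed_density_def)
qed

text \<open>
  Every sum in the supremum that defines the total variation is at most \<open>\<integral> \<bar>f\<bar>\<close>, because
  \<open>\<bar>\<mu> B\<bar> \<le> \<integral>\<^sub>B \<bar>f\<bar>\<close> and the blocks \<open>B\<close> are disjoint. The measure built from that supremum assigns to a
  set either the supremum or \<open>0\<close> (the value that \<^const>\<open>measure_of\<close> assigns to a set function
  that is not countably additive, and to sets that are not measurable), so the bound holds
  in all cases.
\<close>

lemma total_variation_signed_density_le:
  assumes f: "set_integrable lborel {0..} f"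
  shows "emeasure (total_variation half_line (signed_density f)) A \<le> (\<integral>\<^sup>+t\<in>{0..}. ennreal \<bar>f t\<bar> \<partial>lborel)"
proof -
  define g where "g t = indicator {0..} t * f t" for t
  have int: "integrable lborel g"
    using f by (simp add: g_def[abs_def] set_integrable_def)
  then have [measurable]: "g \<in> borel_measurable borel" by auto
  define N where "N = density lborel (\<lambda>t. ennreal \<bar>g t\<bar>)"
  have [simp]: "sets N = sets borel" "space N = UNIV" by (simp_all add: N_def)
  have sd_le: "e2ennreal \<bar>signed_density f B\<bar> \<le> emeasure N B" if B: "B \<in> sets half_line" for B
  proof -
    note [measurable] = sets_half_lineD(1)[OF B]
    have ind: "indicator B t * f t = indicator B t * g t" for t
      using sets_half_lineD(2)[OF B] by (auto simp: g_def indicator_def)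
    have intB: "integrable lborel (\<lambda>t. indicator B t * g t)"
      using integrable_real_mult_indicator[of B lborel g] int by (simp add: mult.commute)
    then have "signed_density f B = ereal (LBINT t. indicator B t * g t)"
      by (subst signed_density_eq_integral)
         (auto simp: set_integrable_def set_lebesgue_integral_def ind)
    then have "e2ennreal \<bar>signed_density f B\<bar> = ennreal (norm (LBINT t. indicator B t * g t))"
      by simp
    also have "\<dots> \<le> (\<integral>\<^sup>+t. ennreal (norm (indicator B t * g t)) \<partial>lborel)"
      by (rule integral_norm_bound_ennreal[OF intB])
    also have "\<dots> = emeasure N B"
      unfolding N_def by (subst emeasure_density) (auto intro!: nn_integral_cong simp: indicator_def)
    finally show ?thesis .
  qed
  have "(SUP F \<in> {F. finite F \<and> F \<subseteq> sets half_line \<and> partition_on A F}. \<Sum>B\<in>F. e2ennreal \<bar>signed_density f B\<bar>)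
          \<le> emeasure N UNIV"
  proof (rule SUP_least)
    fix F assume F: "F \<in> {F. finite F \<and> F \<subseteq> sets half_line \<and> partition_on A F}"
    have "(\<Sum>B\<in>F. e2ennreal \<bar>signed_density f B\<bar>) \<le> (\<Sum>B\<in>F. emeasure N B)"
      using F by (intro sum_mono sd_le) auto
    also have "\<dots> = emeasure N (\<Union>B\<in>F. B)"
      using F sets_half_lineD(1)
      by (intro sum_emeasure) (auto simp: partition_on_def disjoint_family_on_def disjoint_def)
    also have "\<dots> \<le> emeasure N UNIV"
      by (rule emeasure_mono) auto
    finally show "(\<Sum>B\<in>F. e2ennreal \<bar>signed_density f B\<bar>) \<le> emeasure N UNIV" .
  qed
  then have "emeasure (total_variation half_line (signed_density f)) A \<le> emeasure N UNIV"
    by (simp add: total_variation_def emeasure_measure_of_conv)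
  also have "emeasure N UNIV = (\<integral>\<^sup>+t. ennreal \<bar>g t\<bar> \<partial>lborel)"
    by (simp add: N_def emeasure_density)
  also have "\<dots> = (\<integral>\<^sup>+t\<in>{0..}. ennreal \<bar>f t\<bar> \<partial>lborel)"
    by (rule nn_integral_cong) (auto simp: g_def indicator_def)
  finally show ?thesis .
qed

text \<open>
  For \<open>x > 0\<close> the weight \<open>exp (- x * t)\<close> is at most \<open>1\<close> on the half-line, so finiteness of the total
  variation of the whole space suffices.
\<close>

lemma signed_density_in_M_L:
  assumes f: "set_integrable lborel {0..} f"
  shows "signed_density f \<in> M_L"
proof -
  let ?V = "total_variation half_line (signed_density f)"
  have "(\<integral>\<^sup>+t. ennreal (exp (- x * t)) \<partial>?V) < \<infinity>" if "x > 0" for x :: real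
  proof -
    have sp: "space ?V = {0..}"
      by (simp add: total_variation_def half_line_def space_measure_of_conv space_restrict_space)
    have "(\<integral>\<^sup>+t. ennreal (exp (- x * t)) \<partial>?V) \<le> (\<integral>\<^sup>+t. 1 \<partial>?V)"
      using that by (intro nn_integral_mono) (auto simp: sp)
    also have "\<dots> \<le> (\<integral>\<^sup>+t\<in>{0..}. ennreal \<bar>f t\<bar> \<partial>lborel)"
      using total_variation_signed_density_le[OF f] by simp
    also have "\<dots> < \<infinity>"
    proof -
      have "(\<integral>\<^sup>+t\<in>{0..}. ennreal \<bar>f t\<bar> \<partial>lborel) = (\<integral>\<^sup>+t. ennreal (norm (indicator {0..} t *\<^sub>R f t)) \<partial>lborel)"
        by (intro nn_integral_cong) (auto simp: indicator_def)
      then show ?thesis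
        using f by (simp add: set_integrable_def integrable_iff_bounded)
    qed
    finally show ?thesis .
  qed
  then show ?thesis
    using signed_measure_signed_density[OF f] by (simp add: M_L_def)
qed

section \<open>The inverse Laplace transform of the derivative of the Gamma quotient\<close>

theorem lemma4p1:
  fixes a :: nat and b :: real
  assumes "a \<ge> 1" and "b > 0" and "b \<notin> real ` {1..<a}"
  shows "(\<forall>y>0. gamma_quot a b y = (\<Prod>i<a. (y + real i) / (y + b + real i))) \<and>
    {- real i | i. i < a} \<inter> {- (b + real i) | i. i < a} = {} \<and>
    (\<forall>y>0. 1 - gamma_quot a b y = (\<Sum>i<a. pf_coeff a b i / (y + b + real i))) \<and>
    (\<Sum>i<a. pf_coeff a b i) = real a * b \<and>
    (\<forall>y>0. gamma_quot a b differentiable at y) \<and>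
    inverse_laplace (rho a b) (deriv (gamma_quot a b)) \<and>
    (\<forall>\<rho>. inverse_laplace \<rho> (deriv (gamma_quot a b)) \<longrightarrow>
         (AE t in lborel. t > 0 \<longrightarrow> \<rho> t = rho a b t)) \<and>
    (\<forall>t>0. rho a b t = (-1) ^ (a + 1) * b * t * exp (- b * t) *
         jacobi_P (a - 1) (b - real a) 1 (1 - 2 * exp (- t))) \<and>
    signed_density (rho a b) \<in> M_L"
proof (intro conjI allI impI)
  let ?d = "\<lambda>y. \<Sum>i<a. pf_coeff a b i / (y + b + real i)\<^sup>2"
  have deriv: "deriv (gamma_quot a b) y = ?d y" if "y > 0" for y
    using gamma_quot_has_derivative[of y b a] that assms by (intro DERIV_imp_deriv) auto
  show "gamma_quot a b y = (\<Prod>i<a. (y + real i) / (y + b + real i))" if "y > 0" for y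
    using gamma_quot_eq_prod that assms by simp
  show "{- real i | i. i < a} \<inter> {- (b + real i) | i. i < a} = {}"
  proof -
    have False if "i < a" "j < a" "real i = b + real j" for i j
    proof -
      have "b = real (i - j)" "i - j \<in> {1..<a}"
        using that assms by (auto simp: of_nat_diff)
      with assms show False by blast
    qed
    then show ?thesis by force
  qed
  show "1 - gamma_quot a b y = (\<Sum>i<a. pf_coeff a b i / (y + b + real i))" if "y > 0" for y
    using one_minus_gamma_quot that assms by simp
  show "(\<Sum>i<a. pf_coeff a b i) = real a * b"
    using sum_pf_coeff assms by simp
  show "gamma_quot a b differentiable at y" if "y > 0" for y
    using gamma_quot_has_derivative[of y b a] that assms
    by (auto simp: real_differentiable_def)
  show inv: "inverse_laplace (rho a b) (deriv (gamma_quot a b))"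
    unfolding inverse_laplace_def
  proof (intro allI impI conjI)
    fix y :: real assume y: "y > 0"
    have *: "has_bochner_integral lborel (\<lambda>t. indicator {0<..} t * (exp (- y * t) * rho a b t)) (?d y)"
      using y assms by (intro laplace_rho) simp
    then show "set_integrable lborel {0<..} (\<lambda>t. exp (- y * t) * rho a b t)"
      by (simp add: set_integrable_def has_bochner_integral_iff)
    show "deriv (gamma_quot a b) y = (LBINT t:{0<..}. exp (- y * t) * rho a b t)"
      using * by (simp add: set_lebesgue_integral_def has_bochner_integral_iff deriv y)
  qed
  show "AE t in lborel. t > 0 \<longrightarrow> \<rho> t = rho a b t"
    if "inverse_laplace \<rho> (deriv (gamma_quot a b))" for \<rho>
    using inverse_laplace_unique[OF that inv] .
  show "rho a b t = (-1) ^ (a + 1) * b * t * exp (- b * t) *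
         jacobi_P (a - 1) (b - real a) 1 (1 - 2 * exp (- t))" for t
    using rho_eq_jacobi assms by simp
  show "signed_density (rho a b) \<in> M_L"
    using signed_density_in_M_L set_integrable_rho assms by simp
qed

end
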